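(* Let $(V,b,m)$ be an infinite, locally finite, connected graph over a non-Archimedean ordered field $\mathbb K$ which is Cauchy complete and has countable cofinality, with $m(x)=b(x)=\sum_{z\in V}b(x,z)$ for all $x\in V$. If $\lim_{n\to\infty}P^n(x,y)=0$ for some (equivalently, all) $x,y\in V$, then for all $\phi\in C_c(V)$ $$\Delta\sum_{n=0}^\infty P^n\phi=\sum_{n=0}^\infty P^n\Delta\phi=\phi .$$ A corresponding statement holds for the restrictions $P_K$ and $\Delta_K$ to finite connected subsets $K\subseteq V$: if $\lim_{n\to\infty}P_K^n(x,y)=0$ for some (equivalently, all) $x,y\in K$, then $\Delta_K\sum_{n=0}^\infty P_K^n\phi=\sum_{n=0}^\infty P_K^n\Delta_K\phi=\phi$ for all $\phi\in C_c(K)$. In particular, in this case, for all $\phi\in C_c(K)$, $$\Delta_K^{-1}\phi=\sum_{n=0}^\infty P_K^n\phi .$$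
   Context: An ordered field $(\mathbb K,\succ)$ is non-Archimedean if there is $\tau\succ0$ with $\tau\prec 1/n$ for all $n\in\mathbb N$. $\mathbb K^+=\{k\in\mathbb K: k\succ0\}$. A sequence $(k_n)$ converges to $k\in\mathbb K$ if for every $c\in\mathbb K^+$ one has $|k_n-k|\preceq c$ for all large $n$. Series of functions converge pointwise on $V$ (respectively $K$). Cauchy complete: every Cauchy sequence converges. Countable cofinality: there is a countable $S\subset\mathbb K$ such that every $k\in\mathbb K$ satisfies $k\preceq s$ for some $s\in S$. A graph $(V,b,m)$ over $\mathbb K$: $V$ is an at most countable set, $m:V\to\mathbb K^+$, and $b:V\times V\to\mathbb K^+\cup\{0\}$ is symmetric with $b(x,x)=0$. Write $x\sim y$ if $b(x,y)\neq0$; locally finite means each vertex has finitely many neighbors; connectedness (of $V$, or of a subset $K$ via paths inside $K$) is with respect to paths $x_0\sim x_1\sim\dots\sim x_n$. $C_c(V)$ is the set of finitely supported functions $V\to\mathbb K$; $C_c(K)$ those supported in $K$, identified with the functions $C(K)$ from $K$ to $\mathbb K$. Laplacian: $\Delta f(x)=\frac1{m(x)}\sum_{y\in V}(f(x)-f(y))b(x,y)$. With $p(x,y)=b(x,y)/b(x)$, the transition operator is $Pf(x)=\sum_{y\in V}p(x,y)f(y)$, so $\Delta=I-P$; $P^0=I$ and $P^n(x,y)=P^n1_y(x)$, where $1_y$ is $1$ at $y$ and $0$ elsewhere. For finite $K$, $P_K$ and $\Delta_K=I-P_K$ are the operators on $C(K)$ obtained by extending functions by $0$ to $V$, applying $P$,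 respectively $\Delta$, and restricting to $K$; $P_K^n(x,y)=P_K^n1_y(x)$. For finite connected $K$, $\Delta_K:C(K)\to C(K)$ is invertible. *)

theory Defs
  imports Complex_Main "HOL-Library.Countable_Set" "HOL-Library.Indicator_Function"
begin

section \<open>Ordered fields\<close>

definition non_archimedean :: "'a::linordered_field itself \<Rightarrow> bool" where
  "non_archimedean _ \<longleftrightarrow> (\<exists>\<tau>::'a. \<tau> > 0 \<and> (\<forall>n::nat. n \<ge> 1 \<longrightarrow> \<tau> < 1 / of_nat n))"

text \<open>Convergence and the Cauchy property are taken with respect to the order, with tolerances
  \<open>c\<close> ranging over the positive elements of the field itself.\<close>

definition converges_to :: "(nat \<Rightarrow> 'a::linordered_field) \<Rightarrow> 'a \<Rightarrow> bool" where
  "converges_to k l \<longleftrightarrow> (\<forall>c>0. \<forall>\<^sub>F n in sequentially. \<bar>k n - l\<bar> \<le> c)"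

definition is_cauchy :: "(nat \<Rightarrow> 'a::linordered_field) \<Rightarrow> bool" where
  "is_cauchy k \<longleftrightarrow> (\<forall>c>0. \<exists>N. \<forall>i\<ge>N. \<forall>j\<ge>N. \<bar>k i - k j\<bar> \<le> c)"

definition cauchy_complete :: "'a::linordered_field itself \<Rightarrow> bool" where
  "cauchy_complete _ \<longleftrightarrow> (\<forall>k::nat \<Rightarrow> 'a. is_cauchy k \<longrightarrow> (\<exists>l. converges_to k l))"

definition countable_cofinality :: "'a::linordered_field itself \<Rightarrow> bool" where
  "countable_cofinality _ \<longleftrightarrow> (\<exists>S::'a set. countable S \<and> (\<forall>k. \<exists>s\<in>S. k \<le> s))"

definition has_series_sum :: "(nat \<Rightarrow> 'a::linordered_field) \<Rightarrow> 'a \<Rightarrow> bool" where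
  "has_series_sum k s \<longleftrightarrow> converges_to (\<lambda>n. \<Sum>i<n. k i) s"

definition series_sum :: "(nat \<Rightarrow> 'a::linordered_field) \<Rightarrow> 'a" where
  "series_sum k = (THE s. has_series_sum k s)"

lemma converges_to_unique:
  fixes k :: "nat \<Rightarrow> 'a::linordered_field"
  assumes "converges_to k l" "converges_to k l'"
  shows "l = l'"
proof (rule ccontr)
  assume "l \<noteq> l'"
  define c where "c = \<bar>l - l'\<bar> / 3"
  have c: "c > 0" using \<open>l \<noteq> l'\<close> by (simp add: c_def)
  have "\<forall>\<^sub>F n in sequentially. \<bar>k n - l\<bar> \<le> c \<and> \<bar>k n - l'\<bar> \<le> c"
    using assms c by (simp add: converges_to_def eventually_conj)
  then obtain n where n: "\<bar>k n - l\<bar> \<le> c" "\<bar>k n - l'\<bar> \<le> c"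
    by (auto simp: eventually_sequentially)
  have "\<bar>l - l'\<bar> \<le> \<bar>k n - l\<bar> + \<bar>k n - l'\<bar>"
    using abs_triangle_ineq4[of "k n - l'" "k n - l"] by simp
  also have "\<dots> \<le> c + c" using n by (rule add_mono)
  also have "\<dots> < 3 * c" using c by simp
  finally show False by (simp add: c_def)
qed

lemma series_sum_eq: "has_series_sum k s \<Longrightarrow> series_sum k = s"
  unfolding series_sum_def has_series_sum_def by (blast intro: converges_to_unique)

definition pointwise_summable :: "'v set \<Rightarrow> (nat \<Rightarrow> 'v \<Rightarrow> 'a::linordered_field) \<Rightarrow> bool" where
  "pointwise_summable X F \<longleftrightarrow> (\<forall>x\<in>X. \<exists>s. has_series_sum (\<lambda>n. F n x) s)"

definition pointwise_sum :: "(nat \<Rightarrow> 'v \<Rightarrow> 'a::linordered_field) \<Rightarrow> 'v \<Rightarrow> 'a" where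
  "pointwise_sum F = (\<lambda>x. series_sum (\<lambda>n. F n x))"


section \<open>Weighted graphs\<close>

locale weighted_graph =
  fixes V :: "'v set" and b :: "'v \<Rightarrow> 'v \<Rightarrow> 'a::linordered_field" and m :: "'v \<Rightarrow> 'a"
  assumes countable_V: "countable V"
    and m_pos: "x \<in> V \<Longrightarrow> m x > 0"
    and b_nonneg: "x \<in> V \<Longrightarrow> y \<in> V \<Longrightarrow> b x y \<ge> 0"
    and b_sym: "x \<in> V \<Longrightarrow> y \<in> V \<Longrightarrow> b x y = b y x"
    and b_diag: "x \<in> V \<Longrightarrow> b x x = 0"

definition neighbors :: "'v set \<Rightarrow> ('v \<Rightarrow> 'v \<Rightarrow> 'a::linordered_field) \<Rightarrow> 'v \<Rightarrow> 'v set" where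
  "neighbors V b x = {y \<in> V. b x y \<noteq> 0}"

definition locally_finite_graph :: "'v set \<Rightarrow> ('v \<Rightarrow> 'v \<Rightarrow> 'a::linordered_field) \<Rightarrow> bool" where
  "locally_finite_graph V b \<longleftrightarrow> (\<forall>x\<in>V. finite (neighbors V b x))"

definition graph_connected :: "('v \<Rightarrow> 'v \<Rightarrow> 'a::linordered_field) \<Rightarrow> 'v set \<Rightarrow> bool" where
  "graph_connected b X \<longleftrightarrow>
     (\<forall>x\<in>X. \<forall>y\<in>X. (x, y) \<in> {(u, v). u \<in> X \<and> v \<in> X \<and> b u v \<noteq> 0}\<^sup>*)"

text \<open>A function on a set \<open>X\<close> of vertices is represented by the function on the whole vertex type
  that vanishes off \<open>X\<close>. Hence \<open>extend0 X\<close> serves both as restriction to \<open>X\<close> and as extension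
  by zero from \<open>X\<close>, \<open>C\<^sub>c(X)\<close> is a set of such functions, and for finite \<open>X\<close> it is
  all of \<open>C(X)\<close>.\<close>

definition extend0 :: "'v set \<Rightarrow> ('v \<Rightarrow> 'a::zero) \<Rightarrow> 'v \<Rightarrow> 'a" where
  "extend0 X f = (\<lambda>x. if x \<in> X then f x else 0)"

definition Cc :: "'v set \<Rightarrow> ('v \<Rightarrow> 'a::zero) set" where
  "Cc X = {f. finite {x. f x \<noteq> 0} \<and> {x. f x \<noteq> 0} \<subseteq> X}"

text \<open>The sums over \<open>y \<in> V\<close> below are written over the neighbors of \<open>x\<close>, since the sum operator
  is \<open>0\<close> on infinite index sets; all omitted summands contain the factor \<open>b x y = 0\<close>. The
  definitions are meant for locally finite graphs.\<close>

definition weight :: "'v set \<Rightarrow> ('v \<Rightarrow> 'v \<Rightarrow> 'a::linordered_field) \<Rightarrow> 'v \<Rightarrow> 'a" where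
  "weight V b x = (\<Sum>z\<in>neighbors V b x. b x z)"

definition laplacian ::
    "'v set \<Rightarrow> ('v \<Rightarrow> 'v \<Rightarrow> 'a::linordered_field) \<Rightarrow> ('v \<Rightarrow> 'a) \<Rightarrow> ('v \<Rightarrow> 'a) \<Rightarrow> 'v \<Rightarrow> 'a" where
  "laplacian V b m f =
     extend0 V (\<lambda>x. 1 / m x * (\<Sum>y\<in>neighbors V b x. (f x - f y) * b x y))"

definition transition ::
    "'v set \<Rightarrow> ('v \<Rightarrow> 'v \<Rightarrow> 'a::linordered_field) \<Rightarrow> ('v \<Rightarrow> 'a) \<Rightarrow> 'v \<Rightarrow> 'a" where
  "transition V b f =
     extend0 V (\<lambda>x. \<Sum>y\<in>neighbors V b x. b x y / weight V b x * f y)"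

definition laplacian_on ::
    "'v set \<Rightarrow> ('v \<Rightarrow> 'v \<Rightarrow> 'a::linordered_field) \<Rightarrow> ('v \<Rightarrow> 'a) \<Rightarrow> 'v set \<Rightarrow> ('v \<Rightarrow> 'a) \<Rightarrow> 'v \<Rightarrow> 'a" where
  "laplacian_on V b m K f = extend0 K (laplacian V b m (extend0 K f))"

definition transition_on ::
    "'v set \<Rightarrow> ('v \<Rightarrow> 'v \<Rightarrow> 'a::linordered_field) \<Rightarrow> 'v set \<Rightarrow> ('v \<Rightarrow> 'a) \<Rightarrow> 'v \<Rightarrow> 'a" where
  "transition_on V b K f = extend0 K (transition V b (extend0 K f))"

definition power_kernel :: "(('v \<Rightarrow> 'a::linordered_field) \<Rightarrow> 'v \<Rightarrow> 'a) \<Rightarrow> nat \<Rightarrow> 'v \<Rightarrow> 'v \<Rightarrow> 'a" where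
  "power_kernel T n x y = (T ^^ n) (indicator {y}) x"

end

theory Submission
  imports Defs
begin

text \<open>In a non-Archimedean field with an element \<open>\<tau>\<close> below every \<open>1 / n\<close>, terms bounded by \<open>\<tau> * c\<close> have all their
  finite sums bounded by \<open>c\<close>. So a series over a Cauchy complete field converges as soon as its
  terms tend to \<open>0\<close>, and \<open>P\<^sup>n(x, y) \<rightarrow> 0\<close> already yields the Green operator \<open>\<Sum>n. P\<^sup>n\<close>. Both
  identities then follow by telescoping from \<open>\<Delta> = I - P\<close>, where \<open>P\<close> passes to pointwise limits by
  local finiteness. The choice of \<open>x, y\<close> is irrelevant since
  \<open>P\<^sup>k(x, x') * P\<^sup>n(x', y') * P\<^sup>l(y', y) \<le> P\<^bsup>k+n+l\<^esup>(x, y)\<close>.\<close>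

section \<open>Sequences and series in ordered fields\<close>

lemma converges_to_const: "converges_to (\<lambda>n. c) (c::'a::linordered_field)"
  by (simp add: converges_to_def)

lemma converges_to_add:
  fixes k :: "nat \<Rightarrow> 'a::linordered_field"
  assumes "converges_to k s" "converges_to l t"
  shows "converges_to (\<lambda>n. k n + l n) (s + t)"
  unfolding converges_to_def
proof (intro allI impI)
  fix c :: 'a assume "c > 0"
  then have "c / 2 > 0" by simp
  then have "\<forall>\<^sub>F n in sequentially. \<bar>k n - s\<bar> \<le> c / 2" "\<forall>\<^sub>F n in sequentially. \<bar>l n - t\<bar> \<le> c / 2"
    using assms unfolding converges_to_def by blast+
  then show "\<forall>\<^sub>F n in sequentially. \<bar>k n + l n - (s + t)\<bar> \<le> c"
  proof eventually_elim
    case (elim n)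
    have "\<bar>k n + l n - (s + t)\<bar> \<le> \<bar>k n - s\<bar> + \<bar>l n - t\<bar>"
      using abs_triangle_ineq[of "k n - s" "l n - t"] by (simp add: algebra_simps)
    also have "\<dots> \<le> c / 2 + c / 2" using elim by (rule add_mono)
    finally show ?case by simp
  qed
qed

lemma converges_to_cmult:
  fixes k :: "nat \<Rightarrow> 'a::linordered_field"
  assumes "converges_to k s"
  shows "converges_to (\<lambda>n. a * k n) (a * s)"
proof (cases "a = 0")
  case False
  show ?thesis
    unfolding converges_to_def
  proof (intro allI impI)
    fix c :: 'a assume "c > 0"
    then have "c / \<bar>a\<bar> > 0" using False by simp
    then have "\<forall>\<^sub>F n in sequentially. \<bar>k n - s\<bar> \<le> c / \<bar>a\<bar>"
      using assms by (auto simp: converges_to_def)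
    then show "\<forall>\<^sub>F n in sequentially. \<bar>a * k n - a * s\<bar> \<le> c"
    proof eventually_elim
      case (elim n)
      have "\<bar>a * k n - a * s\<bar> = \<bar>a\<bar> * \<bar>k n - s\<bar>"
        by (simp add: abs_mult flip: right_diff_distrib)
      then show ?case using elim False by (simp add: field_simps)
    qed
  qed
qed (simp add: converges_to_const)

lemma converges_to_diff:
  fixes k :: "nat \<Rightarrow> 'a::linordered_field"
  assumes "converges_to k s" "converges_to l t"
  shows "converges_to (\<lambda>n. k n - l n) (s - t)"
  using converges_to_add[OF assms(1) converges_to_cmult[OF assms(2), of "-1"]] by simp

lemma converges_to_sum:
  fixes k :: "'i \<Rightarrow> nat \<Rightarrow> 'a::linordered_field"
  assumes "\<And>i. i \<in> I \<Longrightarrow> converges_to (k i) (s i)"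
  shows "converges_to (\<lambda>n. \<Sum>i\<in>I. k i n) (\<Sum>i\<in>I. s i)"
  using assms
  by (induction I rule: infinite_finite_induct) (auto simp: converges_to_const intro: converges_to_add)

lemma converges_to_shift:
  fixes k :: "nat \<Rightarrow> 'a::linordered_field"
  assumes "converges_to k s"
  shows "converges_to (\<lambda>n. k (n + j)) s"
  using assms by (auto simp: converges_to_def eventually_sequentially) (meson trans_le_add1)

lemma converges_to_0_dominated:
  fixes k :: "nat \<Rightarrow> 'a::linordered_field"
  assumes "converges_to l 0" and "\<And>n. 0 \<le> k n" and "\<And>n. k n \<le> l n"
  shows "converges_to k 0"
  unfolding converges_to_def
proof (intro allI impI)
  fix c :: 'a assume "c > 0"
  then have "\<forall>\<^sub>F n in sequentially. \<bar>l n - 0\<bar> \<le> c"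
    using assms(1) by (auto simp: converges_to_def)
  then show "\<forall>\<^sub>F n in sequentially. \<bar>k n - 0\<bar> \<le> c"
  proof eventually_elim
    case (elim n)
    show ?case using elim assms(2,3)[of n] by simp
  qed
qed

lemma null_imp_has_series_sum:
  fixes k :: "nat \<Rightarrow> 'a::linordered_field"
  assumes "non_archimedean TYPE('a)" and "cauchy_complete TYPE('a)" and "converges_to k 0"
  shows "\<exists>s. has_series_sum k s"
proof -
  obtain \<tau> :: 'a where \<tau>: "\<tau> > 0" "\<And>n::nat. n \<ge> 1 \<Longrightarrow> \<tau> < 1 / of_nat n"
    using assms(1) by (auto simp: non_archimedean_def)
  have n\<tau>: "of_nat n * \<tau> \<le> 1" for n :: nat
  proof (cases "n = 0")
    case False
    then have "\<tau> < 1 / of_nat n" using \<tau>(2)[of n] by simp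
    then show ?thesis using False by (simp add: field_simps)
  qed simp
  have "is_cauchy (\<lambda>n. \<Sum>i<n. k i)"
    unfolding is_cauchy_def
  proof (intro allI impI)
    fix c :: 'a assume c: "c > 0"
    \<comment> \<open>The terms are made small on the scale \<open>\<tau> * c\<close>, infinitesimal
      relative to \<open>c\<close>, so that no number of them can add up to more than
      \<open>c\<close>.\<close>
    then have "\<tau> * c > 0" using \<tau>(1) by simp
    then obtain N where N: "\<And>n. n \<ge> N \<Longrightarrow> \<bar>k n\<bar> \<le> \<tau> * c"
      using assms(3) by (auto simp: converges_to_def eventually_sequentially)
    have tail: "\<bar>(\<Sum>n<j. k n) - (\<Sum>n<i. k n)\<bar> \<le> c" if "N \<le> i" "i \<le> j" for i j
    proof -
      have "(\<Sum>n<j. k n) - (\<Sum>n<i. k n) = (\<Sum>n\<in>{i..<j}. k n)"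
        using sum_diff_nat_ivl[of 0 i j k] that by (simp add: atLeast0LessThan)
      also have "\<bar>\<dots>\<bar> \<le> (\<Sum>n\<in>{i..<j}. \<bar>k n\<bar>)" by (rule sum_abs)
      also have "\<dots> \<le> (\<Sum>n\<in>{i..<j}. \<tau> * c)" by (rule sum_mono) (use N that in auto)
      \<comment> \<open>The bound does not depend on the block length: \<open>j - i\<close> copies
        of \<tau> still sum to at most 1.\<close>
      also have "\<dots> = (of_nat (j - i) * \<tau>) * c" by (simp add: mult.assoc)
      also have "\<dots> \<le> 1 * c" using n\<tau> c by (intro mult_right_mono) auto
      finally show ?thesis by simp
    qed
    show "\<exists>N. \<forall>i\<ge>N. \<forall>j\<ge>N. \<bar>(\<Sum>n<i. k n) - (\<Sum>n<j. k n)\<bar> \<le> c"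
      using tail by (metis abs_minus_commute nle_le)
  qed
  then show ?thesis
    using assms(2) by (auto simp: cauchy_complete_def has_series_sum_def)
qed

section \<open>Finite range operators with positive kernel\<close>

text \<open>Common frame for \<open>P\<close> on \<open>V\<close> and \<open>P_K\<close> on
  \<open>K\<close>: \<open>N x\<close> holds the neighbors of \<open>x\<close> inside
  \<open>X\<close>, and \<open>connected\<close> speaks of paths in \<open>X\<close>. The rows of
  \<open>p\<close> may sum to less than 1, as happens for \<open>P_K\<close> when edges leave
  \<open>K\<close>.\<close>

locale positive_operator =
  fixes X :: "'v set" and N :: "'v \<Rightarrow> 'v set" and p :: "'v \<Rightarrow> 'v \<Rightarrow> 'a::linordered_field"
    and T :: "('v \<Rightarrow> 'a) \<Rightarrow> 'v \<Rightarrow> 'a"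
  assumes finite_N: "x \<in> X \<Longrightarrow> finite (N x)"
    and N_subset: "x \<in> X \<Longrightarrow> N x \<subseteq> X"
    and p_pos: "x \<in> X \<Longrightarrow> y \<in> N x \<Longrightarrow> p x y > 0"
    and connected: "x \<in> X \<Longrightarrow> y \<in> X \<Longrightarrow> (x, y) \<in> {(u, v). u \<in> X \<and> v \<in> N u}\<^sup>*"
    and T_eq: "T f = extend0 X (\<lambda>x. \<Sum>y\<in>N x. p x y * f y)"
begin

lemma T_outside: "x \<notin> X \<Longrightarrow> T f x = 0"
  by (simp add: T_eq extend0_def)

text \<open>A positive power ends with an application of \<open>T\<close>, which cuts off outside
  \<open>X\<close>; the value of \<open>f\<close> enters at \<open>n = 0\<close>.\<close>

lemma T_pow_outside: "x \<notin> X \<Longrightarrow> f x = 0 \<Longrightarrow> (T ^^ n) f x = 0"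
  by (cases n) (auto simp: T_outside)

text \<open>Linearity is stated for whole linear combinations, the form in which it meets the
  expansion of a finitely supported function and the partial sums of the Green series.\<close>

lemma T_sum: "T (\<lambda>x. \<Sum>i\<in>I. c i * f i x) = (\<lambda>x. \<Sum>i\<in>I. c i * T (f i) x)"
proof
  fix x
  have "(\<Sum>y\<in>N x. p x y * (\<Sum>i\<in>I. c i * f i y)) = (\<Sum>i\<in>I. c i * (\<Sum>y\<in>N x. p x y * f i y))"
    unfolding sum_distrib_left by (subst sum.swap) (simp add: mult.left_commute)
  then show "T (\<lambda>x. \<Sum>i\<in>I. c i * f i x) x = (\<Sum>i\<in>I. c i * T (f i) x)"
    by (simp add: T_eq extend0_def)
qed

lemma T_pow_sum: "(T ^^ n) (\<lambda>x. \<Sum>i\<in>I. c i * f i x) = (\<lambda>x. \<Sum>i\<in>I. c i * (T ^^ n) (f i) x)"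
  by (induction n) (simp_all add: T_sum)

lemma T_pow_cmult: "(T ^^ n) (\<lambda>x. c * f x) = (\<lambda>x. c * (T ^^ n) f x)"
  using T_pow_sum[of n "\<lambda>_. c" "\<lambda>_. f" "{()}"] by simp

lemma T_diff: "T (\<lambda>x. f x - g x) = (\<lambda>x. T f x - T g x)"
  by (auto simp: T_eq extend0_def right_diff_distrib sum_subtractf)

lemma T_pow_diff: "(T ^^ n) (\<lambda>x. f x - g x) = (\<lambda>x. (T ^^ n) f x - (T ^^ n) g x)"
  by (induction n) (simp_all add: T_diff)

lemma T_pow_mono:
  assumes "\<And>x. f x \<le> g x"
  shows "(T ^^ n) f x \<le> (T ^^ n) g x"
proof (induction n arbitrary: x)
  case (Suc n)
  then show ?case
    by (auto simp: T_eq extend0_def intro!: sum_mono mult_left_mono less_imp_le[OF p_pos])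
qed (simp add: assms)

lemma T_pow_nonneg:
  assumes "\<And>x. 0 \<le> f x"
  shows "0 \<le> (T ^^ n) f x"
  \<comment> \<open>The zero function is written as \<open>0 * f x\<close>, so that homogeneity
    evaluates its image.\<close>
  using T_pow_mono[of "\<lambda>x. 0 * f x" f n x] assms unfolding T_pow_cmult by simp

section \<open>Kernels of the powers and their decay\<close>

lemma kernel_nonneg: "0 \<le> power_kernel T n x y"
  unfolding power_kernel_def by (rule T_pow_nonneg) simp

text \<open>This keeps the single term \<open>u = z\<close> of the Chapman-Kolmogorov sum over
  intermediate points \<open>u\<close>. Instead of expanding that sum, the proof applies the
  monotone \<open>T ^^ k\<close> to the pointwise bound of \<open>?g z * indicator {z}\<close> by
  \<open>?g\<close>.\<close>

lemma kernel_mult_le: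
  "power_kernel T k x z * power_kernel T n z y \<le> power_kernel T (k + n) x y"
proof -
  let ?g = "(T ^^ n) (indicator {y})"
  have "(T ^^ k) (\<lambda>u. ?g z * indicator {z} u) x \<le> (T ^^ k) ?g x"
    by (rule T_pow_mono) (auto simp: indicator_def intro: T_pow_nonneg)
  then show ?thesis
    unfolding T_pow_cmult by (simp add: power_kernel_def funpow_add mult.commute)
qed

lemma kernel_1:
  assumes "x \<in> X" "y \<in> N x"
  shows "power_kernel T 1 x y = p x y"
  using assms finite_N[OF assms(1)]
  by (simp add: power_kernel_def T_eq extend0_def indicator_def if_distrib sum.delta' cong: if_cong)

text \<open>Follow a path from \<open>x\<close> to \<open>y\<close>: each edge contributes a
  positive factor \<open>p\<close>, and \<open>kernel_mult_le\<close> multiplies the factors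
  together.\<close>

lemma ex_kernel_pos:
  assumes "x \<in> X" "y \<in> X"
  shows "\<exists>k. power_kernel T k x y > 0"
  using connected[OF assms]
proof induction
  case base
  have "power_kernel T 0 x x > 0" by (simp add: power_kernel_def)
  then show ?case ..
next
  case (step y z)
  then obtain k where "power_kernel T k x y > 0" by blast
  moreover have "power_kernel T 1 y z > 0" using step kernel_1 p_pos by simp
  ultimately have "power_kernel T k x y * power_kernel T 1 y z > 0" by simp
  then have "power_kernel T (k + 1) x z > 0" using kernel_mult_le by (rule less_le_trans)
  then show ?case ..
qed

lemma kernel_null:
  assumes "x \<in> X" "y \<in> X" "x' \<in> X" "y' \<in> X" and null: "converges_to (\<lambda>n. power_kernel T n x y) 0"
  shows "converges_to (\<lambda>n. power_kernel T n x' y') 0"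
proof -
  obtain k where k: "power_kernel T k x x' > 0" using ex_kernel_pos assms by blast
  obtain l where l: "power_kernel T l y' y > 0" using ex_kernel_pos assms by blast
  \<comment> \<open>The fixed detours from \<open>x\<close> to \<open>x'\<close> and from
    \<open>y'\<close> to \<open>y\<close> cost the positive constant \<open>C\<close>, independent
    of \<open>n\<close>; dividing by it bounds one kernel by a shifted copy of the other.\<close>
  define C where "C = power_kernel T k x x' * power_kernel T l y' y"
  have C: "C > 0" using k l by (simp add: C_def)
  have le: "power_kernel T n x' y' \<le> 1 / C * power_kernel T (n + (k + l)) x y" for n
  proof -
    have "power_kernel T n x' y' * C
        = power_kernel T k x x' * (power_kernel T n x' y' * power_kernel T l y' y)"
      by (simp add: C_def algebra_simps)
    also have "\<dots> \<le> power_kernel T k x x' * power_kernel T (n + l) x' y"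
      using k by (intro mult_left_mono kernel_mult_le) simp
    also have "\<dots> \<le> power_kernel T (k + (n + l)) x y" by (rule kernel_mult_le)
    finally show ?thesis using C by (simp add: field_simps)
  qed
  have "converges_to (\<lambda>n. 1 / C * power_kernel T (n + (k + l)) x y) 0"
    using converges_to_cmult[OF converges_to_shift[OF null], of "1 / C" "k + l"] by simp
  then show ?thesis by (rule converges_to_0_dominated) (rule kernel_nonneg, rule le)
qed

lemma kernel_null_iff:
  assumes "X \<noteq> {}"
  shows "(\<exists>x\<in>X. \<exists>y\<in>X. converges_to (\<lambda>n. power_kernel T n x y) 0) \<longleftrightarrow>
    (\<forall>x\<in>X. \<forall>y\<in>X. converges_to (\<lambda>n. power_kernel T n x y) 0)"
  using kernel_null assms by blast

text \<open>A finitely supported function is a finite combination of indicators of points of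
  \<open>X\<close>, so its iterates are finite combinations of null kernel sequences.\<close>

lemma T_pow_null:
  assumes "\<forall>x\<in>X. \<forall>y\<in>X. converges_to (\<lambda>n. power_kernel T n x y) 0" and "\<phi> \<in> Cc X" and "x \<in> X"
  shows "converges_to (\<lambda>n. (T ^^ n) \<phi> x) 0"
proof -
  define S where "S = {x. \<phi> x \<noteq> 0}"
  have S: "finite S" "S \<subseteq> X" using assms(2) by (auto simp: Cc_def S_def)
  have \<phi>: "\<phi> = (\<lambda>x. \<Sum>y\<in>S. \<phi> y * indicator {y} x)"
  proof
    fix x
    have "(\<Sum>y\<in>S. \<phi> y * indicator {y} x) = (\<Sum>y\<in>S. if y = x then \<phi> y else 0)"
      by (rule sum.cong) (auto simp: indicator_def)
    also have "\<dots> = \<phi> x" using S(1) by (simp add: S_def)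
    finally show "\<phi> x = (\<Sum>y\<in>S. \<phi> y * indicator {y} x)" ..
  qed
  have "(T ^^ n) \<phi> x = (\<Sum>y\<in>S. \<phi> y * power_kernel T n x y)" for n
    using arg_cong[OF \<phi>, of "\<lambda>f. (T ^^ n) f x"] by (simp only: T_pow_sum power_kernel_def)
  moreover have "converges_to (\<lambda>n. \<Sum>y\<in>S. \<phi> y * power_kernel T n x y) (\<Sum>y\<in>S. \<phi> y * 0)"
    using S assms by (intro converges_to_sum converges_to_cmult) auto
  ultimately show ?thesis by simp
qed

text \<open>The value of \<open>T\<close> at \<open>x\<close> is a finite sum over
  \<open>N x\<close>, which lies in \<open>X\<close>; pointwise limits therefore pass through
  \<open>T\<close> without any uniformity.\<close>

lemma T_converges:
  assumes "\<And>y. y \<in> X \<Longrightarrow> converges_to (\<lambda>n. f n y) (g y)" and "x \<in> X"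
  shows "converges_to (\<lambda>n. T (f n) x) (T g x)"
  unfolding T_eq extend0_def using assms N_subset
  by (auto intro!: converges_to_sum converges_to_cmult)

section \<open>The Green operator as inverse of the Laplacian\<close>

lemma telescope: "(\<Sum>i<n. (T ^^ i) f x - (T ^^ Suc i) f x) = f x - (T ^^ n) f x"
  by (induction n) simp_all

text \<open>\<open>D\<close> stands for the Laplacian. It is assumed to be \<open>I - T\<close> on
  functions vanishing off \<open>X\<close> because the restricted Laplacian cuts its result off
  outside \<open>X\<close>, so elsewhere the formula would fail at points where \<open>f\<close> is
  nonzero.\<close>

context
  fixes \<phi> :: "'v \<Rightarrow> 'a" and D :: "('v \<Rightarrow> 'a) \<Rightarrow> 'v \<Rightarrow> 'a"
  assumes non_arch: "non_archimedean TYPE('a)" and complete: "cauchy_complete TYPE('a)"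
    and null: "\<forall>x\<in>X. \<forall>y\<in>X. converges_to (\<lambda>n. power_kernel T n x y) 0"
    and \<phi>: "\<phi> \<in> Cc X"
    and D: "\<And>f. (\<And>x. x \<notin> X \<Longrightarrow> f x = 0) \<Longrightarrow> D f = (\<lambda>x. f x - T f x)"
begin

private lemma \<phi>_outside: "x \<notin> X \<Longrightarrow> \<phi> x = 0"
  using \<phi> by (auto simp: Cc_def)

private lemma T_pow_null': "converges_to (\<lambda>n. (T ^^ n) \<phi> x) 0"
  using T_pow_null[OF null \<phi>] T_pow_outside[of x \<phi>] \<phi>_outside
  by (cases "x \<in> X") (auto simp: converges_to_const)

lemma green_has_sum: "has_series_sum (\<lambda>n. (T ^^ n) \<phi> x) (pointwise_sum (\<lambda>n. (T ^^ n) \<phi>) x)"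
  using null_imp_has_series_sum[OF non_arch complete T_pow_null'] series_sum_eq
  unfolding pointwise_sum_def by metis

text \<open>Every term of the series vanishes off \<open>X\<close>, the one for \<open>n = 0\<close>
  because \<phi> does. This makes the assumption on \<open>D\<close> applicable to the infinite
  sum.\<close>

lemma green_outside: "x \<notin> X \<Longrightarrow> pointwise_sum (\<lambda>n. (T ^^ n) \<phi>) x = 0"
  unfolding pointwise_sum_def
  by (rule series_sum_eq)
     (simp add: T_pow_outside \<phi>_outside has_series_sum_def converges_to_const)

text \<open>Since \<open>D \<phi> = \<phi> - T \<phi>\<close> and \<open>T\<close> commutes with its
  powers, the partial sums telescope to \<open>\<phi> - (T ^^ n) \<phi>\<close>, whose last term
  tends to 0.\<close>

lemma green_D_has_sum: "has_series_sum (\<lambda>n. (T ^^ n) (D \<phi>) x) (\<phi> x)"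
proof -
  have "(T ^^ n) (D \<phi>) x = (T ^^ n) \<phi> x - (T ^^ Suc n) \<phi> x" for n
    by (simp add: D[OF \<phi>_outside] T_pow_diff funpow_swap1)
  then have "(\<Sum>i<n. (T ^^ i) (D \<phi>) x) = \<phi> x - (T ^^ n) \<phi> x" for n
    using telescope by simp
  then show ?thesis
    using converges_to_diff[OF converges_to_const T_pow_null', of "\<phi> x"]
    by (simp add: has_series_sum_def)
qed

lemma green_D: "pointwise_sum (\<lambda>n. (T ^^ n) (D \<phi>)) = \<phi>"
  using green_D_has_sum by (auto simp: pointwise_sum_def intro!: series_sum_eq)

text \<open>On \<open>X\<close>, the sequence \<open>?S n - T (?S n)\<close> has two limits: \<phi>
  by telescoping, and \<open>?G - T ?G\<close> because \<open>T\<close> respects pointwise limits.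
  Uniqueness of limits identifies them; off \<open>X\<close> everything is 0.\<close>

lemma D_green: "D (pointwise_sum (\<lambda>n. (T ^^ n) \<phi>)) = \<phi>"
proof
  fix x
  let ?G = "pointwise_sum (\<lambda>n. (T ^^ n) \<phi>)" and ?S = "\<lambda>n x. \<Sum>i<n. (T ^^ i) \<phi> x"
  have S: "converges_to (\<lambda>n. ?S n y) (?G y)" for y
    using green_has_sum by (simp add: has_series_sum_def)
  have "D ?G x = ?G x - T ?G x" by (simp add: D[OF green_outside])
  also have "\<dots> = \<phi> x"
  proof (cases "x \<in> X")
    case True
    have "?S n x - T (?S n) x = \<phi> x - (T ^^ n) \<phi> x" for n
      using T_sum[of "\<lambda>_. 1" "\<lambda>i. (T ^^ i) \<phi>" "{..<n}"] telescope[of \<phi> x n]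
      by (simp add: sum_subtractf)
    then have "converges_to (\<lambda>n. ?S n x - T (?S n) x) (\<phi> x)"
      using converges_to_diff[OF converges_to_const T_pow_null', of "\<phi> x"] by simp
    moreover have "converges_to (\<lambda>n. ?S n x - T (?S n) x) (?G x - T ?G x)"
      by (intro converges_to_diff S T_converges True)
    ultimately show ?thesis by (rule converges_to_unique[rotated])
  qed (simp add: green_outside \<phi>_outside T_outside)
  finally show "D ?G x = \<phi> x" .
qed

end

text \<open>The summability clauses guarantee that the sums, defined by a description operator, are
  genuine limits on \<open>X\<close>.\<close>

lemma green:
  assumes "non_archimedean TYPE('a)" "cauchy_complete TYPE('a)"
    and "\<forall>x\<in>X. \<forall>y\<in>X. converges_to (\<lambda>n. power_kernel T n x y) 0" and "\<phi> \<in> Cc X"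
    and "\<And>f. (\<And>x. x \<notin> X \<Longrightarrow> f x = 0) \<Longrightarrow> D f = (\<lambda>x. f x - T f x)"
  shows "pointwise_summable X (\<lambda>n. (T ^^ n) \<phi>) \<and>
         pointwise_summable X (\<lambda>n. (T ^^ n) (D \<phi>)) \<and>
         D (pointwise_sum (\<lambda>n. (T ^^ n) \<phi>)) = pointwise_sum (\<lambda>n. (T ^^ n) (D \<phi>)) \<and>
         pointwise_sum (\<lambda>n. (T ^^ n) (D \<phi>)) = \<phi>"
  using green_has_sum[OF assms] green_D_has_sum[OF assms] green_D[OF assms] D_green[OF assms]
  unfolding pointwise_summable_def by auto

text \<open>For finite \<open>X\<close> the set \<open>Cc X\<close> consists of all functions
  vanishing off \<open>X\<close>, so it contains the Green sums. The map \<open>G\<close> is then a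
  two-sided inverse of \<open>D\<close> on \<open>Cc X\<close>, and bijectivity of \<open>D\<close>
  comes out as part of the conclusion.\<close>

lemma green_inverse:
  assumes "non_archimedean TYPE('a)" "cauchy_complete TYPE('a)" and "finite X"
    and "\<forall>x\<in>X. \<forall>y\<in>X. converges_to (\<lambda>n. power_kernel T n x y) 0"
    and D: "\<And>f. (\<And>x. x \<notin> X \<Longrightarrow> f x = 0) \<Longrightarrow> D f = (\<lambda>x. f x - T f x)"
  shows "bij_betw D (Cc X) (Cc X)"
    and "\<phi> \<in> Cc X \<Longrightarrow> inv_into (Cc X) D \<phi> = pointwise_sum (\<lambda>n. (T ^^ n) \<phi>)"
proof -
  define G where "G \<phi> = pointwise_sum (\<lambda>n. (T ^^ n) \<phi>)" for \<phi>
  have Cc: "f \<in> Cc X \<longleftrightarrow> (\<forall>x. x \<notin> X \<longrightarrow> f x = 0)" for f :: "'v \<Rightarrow> 'a"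
    using finite_subset[OF _ \<open>finite X\<close>, of "{x. f x \<noteq> 0}"] by (auto simp: Cc_def)
  have G: "G f \<in> Cc X" "D (G f) = f" "pointwise_sum (\<lambda>n. (T ^^ n) (D f)) = f" if "f \<in> Cc X" for f
    using green_outside[OF assms(1,2,4) that D] D_green[OF assms(1,2,4) that D]
      green_D[OF assms(1,2,4) that D] by (auto simp: G_def Cc)
  have DC: "D f \<in> Cc X" if "f \<in> Cc X" for f
    using that D[of f] by (auto simp: Cc T_outside)
  show bij: "bij_betw D (Cc X) (Cc X)"
    by (rule bij_betw_byWitness[where f' = G]) (use G DC in \<open>auto simp: G_def\<close>)
  show "inv_into (Cc X) D \<phi> = pointwise_sum (\<lambda>n. (T ^^ n) \<phi>)" if "\<phi> \<in> Cc X"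
    using inv_into_f_f[OF bij_betw_imp_inj_on[OF bij] G(1)[OF that]] G(2)[OF that] by (simp add: G_def)
qed

end

section \<open>Transition operators of graphs\<close>

text \<open>With its counterpart for the Laplacian, this makes the whole graph the case
  \<open>K = V\<close> of the restricted operators, so one argument serves both halves of the
  theorem.\<close>

lemma transition_on_V: "transition_on V b V = transition V b"
  by (auto simp: fun_eq_iff transition_on_def transition_def extend0_def neighbors_def intro!: sum.cong)

lemma laplacian_on_V: "laplacian_on V b m V = laplacian V b m"
  by (auto simp: fun_eq_iff laplacian_on_def laplacian_def extend0_def neighbors_def intro!: sum.cong)

text \<open>Extending \<open>f\<close> by zero shrinks the sum to neighbors in \<open>K\<close>,
  while the normalization stays the weight in all of \<open>V\<close>. This is the shape required by
  \<open>positive_operator\<close>.\<close>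

lemma transition_on_eq:
  assumes "locally_finite_graph V b" "K \<subseteq> V"
  shows "transition_on V b K f =
    extend0 K (\<lambda>x. \<Sum>y\<in>neighbors V b x \<inter> K. b x y / weight V b x * f y)"
proof
  fix x
  show "transition_on V b K f x =
    extend0 K (\<lambda>x. \<Sum>y\<in>neighbors V b x \<inter> K. b x y / weight V b x * f y) x"
  proof (cases "x \<in> K")
    case True
    then have "finite (neighbors V b x)" "x \<in> V"
      using assms by (auto simp: locally_finite_graph_def)
    then show ?thesis using True
      by (simp add: transition_on_def transition_def extend0_def if_distrib sum.inter_restrict cong: if_cong)
  qed (simp add: transition_on_def extend0_def)
qed

lemma positive_operator_transition_on:
  assumes "weighted_graph V b m" "locally_finite_graph V b" "\<forall>x\<in>V. m x = weight V b x"
    and "K \<subseteq> V" "graph_connected b K"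
  shows "positive_operator K (\<lambda>x. neighbors V b x \<inter> K) (\<lambda>x y. b x y / weight V b x) (transition_on V b K)"
proof
  fix x y assume x: "x \<in> K"
  show "finite (neighbors V b x \<inter> K)" "neighbors V b x \<inter> K \<subseteq> K"
    using assms x by (auto simp: locally_finite_graph_def)
  show "b x y / weight V b x > 0" if "y \<in> neighbors V b x \<inter> K"
  proof -
    have V: "x \<in> V" "y \<in> V" "b x y \<noteq> 0" using x that assms(4) by (auto simp: neighbors_def)
    then have "b x y > 0" using weighted_graph.b_nonneg[OF assms(1), of x y] by simp
    \<comment> \<open>Positivity of the weight is inherited from \<open>m\<close>, with which it
      agrees on \<open>V\<close>.\<close>
    moreover have "weight V b x > 0" using weighted_graph.m_pos[OF assms(1), of x] assms(3) V by simp
    ultimately show ?thesis by simp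
  qed
  assume y: "y \<in> K"
  have "{(u, v). u \<in> K \<and> v \<in> K \<and> b u v \<noteq> 0} = {(u, v). u \<in> K \<and> v \<in> neighbors V b u \<inter> K}"
    using assms(4) by (auto simp: neighbors_def)
  then show "(x, y) \<in> {(u, v). u \<in> K \<and> v \<in> neighbors V b u \<inter> K}\<^sup>*"
    using assms(5) x y by (simp add: graph_connected_def)
qed (rule transition_on_eq[OF assms(2,4)])

text \<open>The normalization \<open>m = weight\<close> turns the diagonal part of the Laplacian
  into the identity. Off \<open>K\<close> both sides are 0, which uses that \<open>f\<close>
  vanishes there.\<close>

lemma laplacian_on_eq:
  assumes "weighted_graph V b m" "\<forall>x\<in>V. m x = weight V b x" "K \<subseteq> V" and f: "\<And>x. x \<notin> K \<Longrightarrow> f x = 0"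
  shows "laplacian_on V b m K f = (\<lambda>x. f x - transition_on V b K f x)"
proof
  fix x
  show "laplacian_on V b m K f x = f x - transition_on V b K f x"
  proof (cases "x \<in> K")
    case True
    then have x: "x \<in> V" using assms(3) by blast
    have m: "m x > 0" using weighted_graph.m_pos[OF assms(1) x] .
    have f': "extend0 K f = f" using f by (auto simp: extend0_def)
    have "1 / m x * (\<Sum>y\<in>neighbors V b x. (f x - f y) * b x y) =
        1 / m x * (f x * weight V b x - (\<Sum>y\<in>neighbors V b x. b x y * f y))"
      unfolding weight_def left_diff_distrib sum_subtractf sum_distrib_left by (simp only: mult.commute)
    also have "\<dots> = f x - (\<Sum>y\<in>neighbors V b x. b x y / weight V b x * f y)"
      using assms(2) x m by (simp add: right_diff_distrib sum_divide_distrib)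
    finally show ?thesis using True x
      by (simp add: laplacian_on_def transition_on_def f') (simp add: laplacian_def transition_def extend0_def)
  qed (simp add: laplacian_on_def transition_on_def extend0_def f)
qed

section \<open>The Green operator on the whole graph and on finite connected subsets\<close>

theorem theorem8p2:
  fixes V :: "'v set" and b :: "'v \<Rightarrow> 'v \<Rightarrow> 'a::linordered_field" and m :: "'v \<Rightarrow> 'a"
  defines "P \<equiv> transition V b" and "L \<equiv> laplacian V b m"
    and "PK \<equiv> transition_on V b" and "LK \<equiv> laplacian_on V b m"
  assumes "non_archimedean TYPE('a)" and "cauchy_complete TYPE('a)"
    and "countable_cofinality TYPE('a)"
    and "weighted_graph V b m"
    and "infinite V" and "locally_finite_graph V b" and "graph_connected b V"
    and "\<forall>x\<in>V. m x = weight V b x"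
  shows
    "((\<exists>x\<in>V. \<exists>y\<in>V. converges_to (\<lambda>n. power_kernel P n x y) 0) \<longleftrightarrow>
        (\<forall>x\<in>V. \<forall>y\<in>V. converges_to (\<lambda>n. power_kernel P n x y) 0)) \<and>
     ((\<exists>x\<in>V. \<exists>y\<in>V. converges_to (\<lambda>n. power_kernel P n x y) 0) \<longrightarrow>
        (\<forall>\<phi>\<in>Cc V.
           pointwise_summable V (\<lambda>n. (P ^^ n) \<phi>) \<and>
           pointwise_summable V (\<lambda>n. (P ^^ n) (L \<phi>)) \<and>
           L (pointwise_sum (\<lambda>n. (P ^^ n) \<phi>)) = pointwise_sum (\<lambda>n. (P ^^ n) (L \<phi>)) \<and>
           pointwise_sum (\<lambda>n. (P ^^ n) (L \<phi>)) = \<phi>)) \<and>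
     (\<forall>K. K \<subseteq> V \<and> finite K \<and> K \<noteq> {} \<and> graph_connected b K \<longrightarrow>
        ((\<exists>x\<in>K. \<exists>y\<in>K. converges_to (\<lambda>n. power_kernel (PK K) n x y) 0) \<longleftrightarrow>
           (\<forall>x\<in>K. \<forall>y\<in>K. converges_to (\<lambda>n. power_kernel (PK K) n x y) 0)) \<and>
        ((\<exists>x\<in>K. \<exists>y\<in>K. converges_to (\<lambda>n. power_kernel (PK K) n x y) 0) \<longrightarrow>
           (\<forall>\<phi>\<in>Cc K.
              pointwise_summable K (\<lambda>n. (PK K ^^ n) \<phi>) \<and>
              pointwise_summable K (\<lambda>n. (PK K ^^ n) (LK K \<phi>)) \<and>
              LK K (pointwise_sum (\<lambda>n. (PK K ^^ n) \<phi>)) =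
                pointwise_sum (\<lambda>n. (PK K ^^ n) (LK K \<phi>)) \<and>
              pointwise_sum (\<lambda>n. (PK K ^^ n) (LK K \<phi>)) = \<phi>) \<and>
           bij_betw (LK K) (Cc K) (Cc K) \<and>
           (\<forall>\<phi>\<in>Cc K. inv_into (Cc K) (LK K) \<phi> = pointwise_sum (\<lambda>n. (PK K ^^ n) \<phi>))))"
proof -
  note graph = assms(8,10,12)
  have pos: "positive_operator K (\<lambda>x. neighbors V b x \<inter> K) (\<lambda>x y. b x y / weight V b x) (PK K)"
    if "K \<subseteq> V" "graph_connected b K" for K
    unfolding PK_def using graph that by (rule positive_operator_transition_on)
  have LK: "LK K f = (\<lambda>x. f x - PK K f x)" if "K \<subseteq> V" "\<And>x. x \<notin> K \<Longrightarrow> f x = 0" for K f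
    unfolding LK_def PK_def using graph(1,3) that by (rule laplacian_on_eq)
  have V: "P = PK V" "L = LK V"
    by (simp_all add: P_def PK_def L_def LK_def transition_on_V laplacian_on_V)
  \<comment> \<open>Nonemptiness of \<open>K\<close> matters: over the empty set the existential
    side is false and the universal side true.\<close>
  have iff: "(\<exists>x\<in>K. \<exists>y\<in>K. converges_to (\<lambda>n. power_kernel (PK K) n x y) 0) \<longleftrightarrow>
      (\<forall>x\<in>K. \<forall>y\<in>K. converges_to (\<lambda>n. power_kernel (PK K) n x y) 0)"
    if "K \<subseteq> V" "K \<noteq> {}" "graph_connected b K" for K
    using positive_operator.kernel_null_iff[OF pos] that by blast
  note green = positive_operator.green[OF pos assms(5,6) _ _ LK]
  note inverse = positive_operator.green_inverse[OF pos assms(5,6) _ _ LK]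
  have "V \<noteq> {}" using assms(9) by auto
  note iffV = iff[OF order_refl this assms(11)]
  show ?thesis
    unfolding V
  \<comment> \<open>The instantiated rules split only conjunctions whose first part is an
    equivalence or an implication, so the conjunctions stating the Green identities stay
    whole.\<close>
  proof (intro conjI[of "_ \<longleftrightarrow> _"] conjI[of "_ \<longrightarrow> _"] allI impI)
    show "(\<exists>x\<in>V. \<exists>y\<in>V. converges_to (\<lambda>n. power_kernel (PK V) n x y) 0) \<longleftrightarrow>
        (\<forall>x\<in>V. \<forall>y\<in>V. converges_to (\<lambda>n. power_kernel (PK V) n x y) 0)"
      by (rule iffV)
  next
    assume "\<exists>x\<in>V. \<exists>y\<in>V. converges_to (\<lambda>n. power_kernel (PK V) n x y) 0"
    then show "\<forall>\<phi>\<in>Cc V.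
           pointwise_summable V (\<lambda>n. (PK V ^^ n) \<phi>) \<and>
           pointwise_summable V (\<lambda>n. (PK V ^^ n) (LK V \<phi>)) \<and>
           LK V (pointwise_sum (\<lambda>n. (PK V ^^ n) \<phi>)) = pointwise_sum (\<lambda>n. (PK V ^^ n) (LK V \<phi>)) \<and>
           pointwise_sum (\<lambda>n. (PK V ^^ n) (LK V \<phi>)) = \<phi>"
      unfolding iffV by (intro ballI green assms(11)) auto
  next
    fix K assume "K \<subseteq> V \<and> finite K \<and> K \<noteq> {} \<and> graph_connected b K"
    then have K: "K \<subseteq> V" "finite K" "K \<noteq> {}" "graph_connected b K" by auto
    note iffK = iff[OF K(1,3,4)]
    show "(\<exists>x\<in>K. \<exists>y\<in>K. converges_to (\<lambda>n. power_kernel (PK K) n x y) 0) \<longleftrightarrow>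
           (\<forall>x\<in>K. \<forall>y\<in>K. converges_to (\<lambda>n. power_kernel (PK K) n x y) 0)"
      by (rule iffK)
    assume "\<exists>x\<in>K. \<exists>y\<in>K. converges_to (\<lambda>n. power_kernel (PK K) n x y) 0"
    then have null: "\<forall>x\<in>K. \<forall>y\<in>K. converges_to (\<lambda>n. power_kernel (PK K) n x y) 0"
      unfolding iffK .
    show "(\<forall>\<phi>\<in>Cc K.
              pointwise_summable K (\<lambda>n. (PK K ^^ n) \<phi>) \<and>
              pointwise_summable K (\<lambda>n. (PK K ^^ n) (LK K \<phi>)) \<and>
              LK K (pointwise_sum (\<lambda>n. (PK K ^^ n) \<phi>)) =
                pointwise_sum (\<lambda>n. (PK K ^^ n) (LK K \<phi>)) \<and>
              pointwise_sum (\<lambda>n. (PK K ^^ n) (LK K \<phi>)) = \<phi>) \<and>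
           bij_betw (LK K) (Cc K) (Cc K) \<and>
           (\<forall>\<phi>\<in>Cc K. inv_into (Cc K) (LK K) \<phi> = pointwise_sum (\<lambda>n. (PK K ^^ n) \<phi>))"
      using green[OF K(1,4) null _ K(1)] inverse[OF K(1,4,2) null K(1)] by blast
  qed
qed

end
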